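(* Let $n\ge 1$, let $A\subseteq\{0,1\}^n$ be nonempty, and let $g:\{0,1\}^n\to\mathbb{R}$ be a function with $g(x)=0$ for all $x\notin A$. Then \[ \mathcal{E}(g,g)\;\ge\; 2\cdot\frac{1}{2^n\,|A|}\,\log_2\!\left(\frac{2^n}{|A|}\right)\cdot\Big(\sum_{x\in A}|g(x)|\Big)^2 . \]
   Context: The discrete cube $\{0,1\}^n$ is viewed as a graph in which two vertices are adjacent ($x\sim y$) iff they differ in exactly one coordinate. For $g:\{0,1\}^n\to\mathbb{R}$, the Dirichlet form is $\mathcal{E}(g,g)=\mathbb{E}_x\sum_{y\sim x}(g(x)-g(y))^2$, where the expectation is over $x$ uniformly distributed on $\{0,1\}^n$. *)

theory Defs
  imports "HOL-Probability.Probability"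
begin

text \<open>
  Points of the cube are extensional functions on the index set \<open>{..<n}\<close>, so that distinct
  elements of \<open>cube n\<close> differ in some coordinate below \<open>n\<close>.
\<close>

definition cube :: "nat \<Rightarrow> (nat \<Rightarrow> nat) set" where
  "cube n = {..<n} \<rightarrow>\<^sub>E {0, 1}"

definition cube_adj :: "nat \<Rightarrow> (nat \<Rightarrow> nat) \<Rightarrow> (nat \<Rightarrow> nat) \<Rightarrow> bool" where
  "cube_adj n x y \<longleftrightarrow> x \<in> cube n \<and> y \<in> cube n \<and> (\<exists>!i. i < n \<and> x i \<noteq> y i)"

text \<open>
  \<open>dirichlet_form n g\<close> is the value on the diagonal, \<open>\<E>(g,g)\<close>. It does not depend on the values
  of \<open>g\<close> outside \<open>cube n\<close>.
\<close>

definition dirichlet_form :: "nat \<Rightarrow> ((nat \<Rightarrow> nat) \<Rightarrow> real) \<Rightarrow> real" where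
  "dirichlet_form n g =
     measure_pmf.expectation (pmf_of_set (cube n)) (\<lambda>x. \<Sum>y | cube_adj n x y. (g x - g y)\<^sup>2)"

end

theory Submission
  imports Defs
begin

text \<open>
  Replacing \<open>g\<close> by \<open>\<bar>g\<bar>\<close> does not increase the energy, so let \<open>g \<ge> 0\<close>. Induct on \<open>n\<close>, splitting the
  cube along its last coordinate. If \<open>g\<close> has sums \<open>a\<close>, \<open>b\<close> on the two halves and \<open>A\<close> has \<open>p\<close>, \<open>q\<close>
  points there, then the edges between the halves contribute at least \<open>(a - b)\<^sup>2 / max p q\<close>, by
  Cauchy-Schwarz on the part of \<open>A\<close> in the half with the larger sum. What remains is a quadratic
  inequality in \<open>a\<close> and \<open>b\<close>. By convexity of \<open>s\<^sup>2 / p\<close> it only gets weaker as \<open>n\<close> grows, so one may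
  take the larger part of \<open>A\<close> to fill its half. With \<open>t = min p q / max p q\<close> its discriminant
  condition is then a consequence of \<open>t \<le> log 2 (1 + t)\<close> and \<open>4 t \<le> (1 + t)\<^sup>2\<close>.
\<close>

section \<open>Scalar two-point inequality\<close>

text \<open>This is \<open>two_point_ordered\<close> at \<open>p = 1\<close>, \<open>q = t\<close>,
  \<open>L = 0\<close>, where the \<open>a\<^sup>2\<close> term vanishes. With \<open>c\<close> the
  coefficient of \<open>(a + b)\<^sup>2\<close>, a quadratic form with leading coefficient
  \<open>1 - c\<close> has to be nonnegative; this follows from \<open>1 - c > 0\<close> and
  \<open>4 * c \<le> (1 - c) * (l / t)\<close>.\<close>

lemma two_point_normalized:
  fixes a b t :: real
  assumes t: "0 < t" "t \<le> 1"
  shows "(a + b)\<^sup>2 / (1 + t) * (1 - log 2 (1 + t)) \<le> b\<^sup>2 / t * log 2 (1 / t) + (a - b)\<^sup>2"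
proof -
  define u where "u = log 2 (1 + t)"
  define l where "l = log 2 (1 / t)"
  define c where "c = (1 - u) / (1 + t)"
  have "2 powr t \<le> 1 + t"
  proof -
    \<comment> \<open>The chord of \<open>exp\<close> over \<open>[0, ln 2]\<close> rises from 1 to
      2.\<close>
    have "exp ((1 - t) *\<^sub>R 0 + t *\<^sub>R ln 2) \<le> (1 - t) * exp 0 + t * exp (ln (2::real))"
      using t by (intro convex_onD[OF exp_convex]) auto
    then show ?thesis by (simp add: powr_def)
  qed
  then have ut: "t \<le> u"
    using t by (simp add: u_def le_log_iff)
  have "4 * t \<le> (1 + t)\<^sup>2"
    using zero_le_power2[of "1 - t"] by (simp add: power2_eq_square algebra_simps)
  then have "log 2 (4 * t) \<le> log 2 ((1 + t)\<^sup>2)"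
    using t by (subst log_le_cancel_iff) auto
  moreover have "log 2 (4 * t) = 2 - l"
    using t log_pow_cancel[of "2::real" 2] by (simp add: log_mult l_def log_divide)
  ultimately have lu: "2 * (1 - u) \<le> l"
    using t by (simp add: u_def log_nat_power)
  have l0: "0 \<le> l"
    using t by (simp add: l_def)
  \<comment> \<open>\<open>lu\<close> bounds \<open>1 - u\<close> by \<open>l / 2\<close>, and
    \<open>ut\<close> turns \<open>2 * t\<close> into \<open>t + u\<close>, the numerator of
    \<open>1 - c\<close>.\<close>
  have "4 * (1 - u) * t \<le> 2 * t * l"
    using mult_left_mono[OF lu, of "2 * t"] t by (simp add: algebra_simps)
  also have "\<dots> \<le> (t + u) * l"
    using ut l0 by (intro mult_right_mono) auto
  finally have "4 * (1 - u) * t / ((1 + t) * t) \<le> (t + u) * l / ((1 + t) * t)"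
    using t by (intro divide_right_mono) auto
  then have "4 * ((1 - u) / (1 + t)) \<le> ((t + u) / (1 + t)) * (l / t)"
    using t by simp
  moreover have c1: "1 - c = (t + u) / (1 + t)"
    using t by (simp add: c_def divide_simps)
  ultimately have disc: "4 * c \<le> (1 - c) * (l / t)"
    by (simp add: c_def)
  have pos: "0 < 1 - c"
    using t ut by (simp add: c1)
  \<comment> \<open>Completing the square after multiplication by \<open>1 - c\<close>; the term
    \<open>4 * c\<close> is \<open>(1 + c)\<^sup>2 - (1 - c)\<^sup>2\<close>.\<close>
  have "0 \<le> ((1 - c) * a - (1 + c) * b)\<^sup>2 + b\<^sup>2 * ((1 - c) * (l / t) - 4 * c)"
    using disc by simp
  also have "\<dots> = (1 - c) * (b\<^sup>2 * (l / t) + (a - b)\<^sup>2 - (a + b)\<^sup>2 * c)"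
    by (simp only: power2_eq_square) algebra
  finally have "0 \<le> b\<^sup>2 * (l / t) + (a - b)\<^sup>2 - (a + b)\<^sup>2 * c"
    using pos by (simp add: zero_le_mult_iff)
  then show ?thesis
    by (simp add: c_def u_def l_def)
qed

text \<open>\<open>s\<^sup>2 / p\<close> is jointly convex and homogeneous of degree one for
  \<open>p > 0\<close>, hence subadditive; the gap is computed explicitly.\<close>

lemma sum_squared_div_le:
  fixes a b p q :: real
  assumes "0 < p" "0 < q"
  shows "(a + b)\<^sup>2 / (p + q) \<le> a\<^sup>2 / p + b\<^sup>2 / q"
proof -
  have "a\<^sup>2 / p + b\<^sup>2 / q - (a + b)\<^sup>2 / (p + q) = (q * a - p * b)\<^sup>2 / (p * q * (p + q))"
    using assms by (simp add: divide_simps) (simp add: power2_eq_square algebra_simps)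
  also have "\<dots> \<ge> 0" using assms by simp
  finally show ?thesis by simp
qed

text \<open>In the induction \<open>L\<close> is the dimension of each half. With
  \<open>L = log 2 p + d\<close> and \<open>d \<ge> 0\<close>, the terms in \<open>d\<close> compare
  by convexity; the rest is \<open>two_point_normalized\<close> at \<open>t = q / p\<close>, divided
  by \<open>p\<close>.\<close>

lemma two_point_ordered:
  fixes a b p q L :: real
  assumes pq: "0 < q" "q \<le> p" and L: "log 2 p \<le> L"
  shows "(a + b)\<^sup>2 / (p + q) * (L + 1 - log 2 (p + q))
    \<le> a\<^sup>2 / p * (L - log 2 p) + b\<^sup>2 / q * (L - log 2 q) + (a - b)\<^sup>2 / p"
proof -
  define t where "t = q / p"
  define d where "d = L - log 2 p"
  have t: "0 < t" "t \<le> 1" and p: "0 < p" using pq by (auto simp: t_def)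
  have q: "q = p * t" using p by (simp add: t_def)
  have sum: "log 2 (p + q) = log 2 p + log 2 (1 + t)"
    using p t by (simp add: q log_mult flip: distrib_left[of p 1 t, simplified])
  have logq: "log 2 q = log 2 p - log 2 (1 / t)"
    using p t by (simp add: q log_mult log_divide)
  have "(a + b)\<^sup>2 / (p + q) * d \<le> (a\<^sup>2 / p + b\<^sup>2 / q) * d"
    using L pq by (intro mult_right_mono sum_squared_div_le) (auto simp: d_def)
  moreover have "(a + b)\<^sup>2 / (p + q) * (1 - log 2 (1 + t))
      \<le> b\<^sup>2 / q * log 2 (1 / t) + (a - b)\<^sup>2 / p"
  proof -
    have "((a + b)\<^sup>2 / (1 + t) * (1 - log 2 (1 + t))) / p
      \<le> (b\<^sup>2 / t * log 2 (1 / t) + (a - b)\<^sup>2) / p"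
      using p by (intro divide_right_mono two_point_normalized t) auto
    moreover have "p + q = p * (1 + t)" by (simp add: q distrib_left)
    ultimately show ?thesis
      by (simp add: q add_divide_distrib mult.commute)
  qed
  moreover have "L + 1 - log 2 (p + q) = d + (1 - log 2 (1 + t))"
      "L - log 2 p = d" "L - log 2 q = d + log 2 (1 / t)"
    by (simp_all add: d_def sum logq)
  ultimately show ?thesis
    by (simp only: distrib_left distrib_right)
qed

lemma two_point:
  fixes a b p q L :: real
  assumes "0 < p" "0 < q" "log 2 p \<le> L" "log 2 q \<le> L"
  shows "(a + b)\<^sup>2 / (p + q) * (L + 1 - log 2 (p + q))
    \<le> a\<^sup>2 / p * (L - log 2 p) + b\<^sup>2 / q * (L - log 2 q) + (a - b)\<^sup>2 / max p q"
proof (cases "q \<le> p")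
  case True
  then show ?thesis using two_point_ordered[of q p L a b] assms by (simp add: max_def)
next
  case False
  then show ?thesis
    using two_point_ordered[of p q L b a] assms
    by (simp add: max_def add.commute power2_commute[of a b])
qed

section \<open>Cauchy-Schwarz across the two halves\<close>

text \<open>Outside \<open>B\<close> only \<open>h\<close> can be nonzero, and there it only lowers
  the difference of the sums. Restricting to \<open>B\<close> therefore loses nothing, and
  Cauchy-Schwarz against the constant 1 costs \<open>card B\<close>.\<close>

lemma sum_diff_squared_le:
  fixes f h :: "'a \<Rightarrow> real"
  assumes X: "finite X" "B \<subseteq> X" and f: "\<And>x. x \<in> X - B \<Longrightarrow> f x = 0"
    and h: "\<And>x. x \<in> X \<Longrightarrow> 0 \<le> h x" and le: "sum h X \<le> sum f X"
  shows "(sum f X - sum h X)\<^sup>2 \<le> real (card B) * (\<Sum>x\<in>X. (f x - h x)\<^sup>2)"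
proof -
  have "sum f X = sum f B" using X f by (intro sum.mono_neutral_right) auto
  moreover have "sum h B \<le> sum h X" using X h by (intro sum_mono2) auto
  ultimately have "sum f X - sum h X \<le> (\<Sum>x\<in>B. f x - h x)"
    by (simp add: sum_subtractf)
  then have "(sum f X - sum h X)\<^sup>2 \<le> (\<Sum>x\<in>B. f x - h x)\<^sup>2"
    using le by (intro power_mono) auto
  also have "\<dots> \<le> (\<Sum>x\<in>B. (f x - h x)\<^sup>2) * (\<Sum>x\<in>B. 1\<^sup>2)"
    using Cauchy_Schwarz_ineq_sum[of "\<lambda>x. f x - h x" "\<lambda>_. 1" B] by simp
  also have "\<dots> \<le> real (card B) * (\<Sum>x\<in>X. (f x - h x)\<^sup>2)"
    using X by (simp add: mult.commute) (intro mult_left_mono sum_mono2, auto)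
  finally show ?thesis .
qed

lemma sum_diff_squared_le_max:
  fixes f h :: "'a \<Rightarrow> real"
  assumes X: "finite X" "B \<subseteq> X" "C \<subseteq> X"
    and f: "\<And>x. x \<in> X - B \<Longrightarrow> f x = 0" "\<And>x. x \<in> X \<Longrightarrow> 0 \<le> f x"
    and h: "\<And>x. x \<in> X - C \<Longrightarrow> h x = 0" "\<And>x. x \<in> X \<Longrightarrow> 0 \<le> h x"
  shows "(sum f X - sum h X)\<^sup>2 \<le> max (real (card B)) (real (card C)) * (\<Sum>x\<in>X. (f x - h x)\<^sup>2)"
proof (cases "sum h X \<le> sum f X")
  case True
  have "(sum f X - sum h X)\<^sup>2 \<le> real (card B) * (\<Sum>x\<in>X. (f x - h x)\<^sup>2)"
    using True assms by (intro sum_diff_squared_le) auto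
  also have "\<dots> \<le> max (real (card B)) (real (card C)) * (\<Sum>x\<in>X. (f x - h x)\<^sup>2)"
    by (intro mult_right_mono sum_nonneg) auto
  finally show ?thesis .
next
  case False
  have "(sum h X - sum f X)\<^sup>2 \<le> real (card C) * (\<Sum>x\<in>X. (h x - f x)\<^sup>2)"
    using False assms by (intro sum_diff_squared_le) auto
  also have "\<dots> \<le> max (real (card B)) (real (card C)) * (\<Sum>x\<in>X. (h x - f x)\<^sup>2)"
    by (intro mult_right_mono sum_nonneg) auto
  finally show ?thesis by (simp only: power2_commute)
qed

section \<open>The cube, coordinate flips and energy\<close>

lemma finite_cube [simp]: "finite (cube n)"
  by (simp add: cube_def finite_PiE)

lemma card_cube: "card (cube n) = 2 ^ n"
  by (simp add: cube_def card_PiE numeral_2_eq_2)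

lemma sum_cube_Suc:
  "sum F (cube (Suc n)) = (\<Sum>x\<in>cube n. F (x(n := 0))) + (\<Sum>x\<in>cube n. F (x(n := 1)))"
proof -
  have "sum F (cube (Suc n)) = (\<Sum>(b, x)\<in>{0, 1} \<times> cube n. F (x(n := b)))"
    unfolding cube_def lessThan_Suc PiE_insert_eq
    using inj_combinator[of n "{..<n}" "\<lambda>_. {0, 1}"]
    by (subst sum.reindex) (simp_all add: case_prod_unfold o_def del: One_nat_def)
  also have "\<dots> = (\<Sum>b\<in>{0, 1}. \<Sum>x\<in>cube n. F (x(n := b)))"
    by (rule sum.cartesian_product[symmetric])
  finally show ?thesis by simp
qed

lemma cube_flip: "x \<in> cube n \<Longrightarrow> i < n \<Longrightarrow> x(i := 1 - x i) \<in> cube n"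
  by (auto simp: cube_def PiE_iff extensional_def)

lemma cube_extend: "x \<in> cube n \<Longrightarrow> b \<in> {0, 1} \<Longrightarrow> x(n := b) \<in> cube (Suc n)"
  by (auto simp: cube_def PiE_iff extensional_def)

text \<open>The Dirichlet form before normalization, with neighbours indexed by the flipped
  coordinate; each edge is counted from both ends.\<close>

definition flip_energy :: "nat \<Rightarrow> ((nat \<Rightarrow> nat) \<Rightarrow> real) \<Rightarrow> real" where
  "flip_energy n g = (\<Sum>x\<in>cube n. \<Sum>i<n. (g x - g (x(i := 1 - x i)))\<^sup>2)"

lemma dirichlet_form_eq: "dirichlet_form n g = flip_energy n g / 2 ^ n"
proof -
  have "(\<Sum>y | cube_adj n x y. (g x - g y)\<^sup>2) = (\<Sum>i<n. (g x - g (x(i := 1 - x i)))\<^sup>2)"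
    if x: "x \<in> cube n" for x
  proof (rule sum.reindex_bij_betw[symmetric, where h = "\<lambda>i. x(i := 1 - x i)"])
    have bin: "z i = 0 \<or> z i = 1" if "z \<in> cube n" "i < n" for z i
      using that by (auto simp: cube_def)
    have ne: "1 - x i \<noteq> x i" if "i < n" for i
      using bin[OF x that] by auto
    show "bij_betw (\<lambda>i. x(i := 1 - x i)) {..<n} {y. cube_adj n x y}"
    proof (rule bij_betw_imageI)
      show "inj_on (\<lambda>i. x(i := 1 - x i)) {..<n}"
      proof (rule inj_onI)
        fix i j assume ij: "i \<in> {..<n}" "j \<in> {..<n}" "x(i := 1 - x i) = x(j := 1 - x j)"
        show "i = j"
          using fun_cong[OF ij(3), of i] ne[of i] ij(1) by (auto split: if_splits)
      qed
      show "(\<lambda>i. x(i := 1 - x i)) ` {..<n} = {y. cube_adj n x y}"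
      proof (intro equalityI subsetI)
        fix y assume "y \<in> (\<lambda>i. x(i := 1 - x i)) ` {..<n}"
        then obtain i where "i < n" "y = x(i := 1 - x i)" by auto
        with ne[of i] have "\<exists>!j. j < n \<and> x j \<noteq> y j"
          by (intro ex1I[of _ i]) (auto split: if_splits)
        then show "y \<in> {y. cube_adj n x y}"
          using x cube_flip[OF x \<open>i < n\<close>] \<open>y = _\<close> by (simp add: cube_adj_def)
      next
        fix y assume "y \<in> {y. cube_adj n x y}"
        then obtain i where y: "y \<in> cube n" and i: "i < n" "x i \<noteq> y i"
          and uniq: "\<And>j. j < n \<Longrightarrow> x j \<noteq> y j \<Longrightarrow> j = i"
          unfolding cube_adj_def by blast
        have "y j = (x(i := 1 - x i)) j" for j
        proof (cases "j < n")
          case True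
          show ?thesis
          proof (cases "j = i")
            case True
            then show ?thesis using bin[OF x i(1)] bin[OF y i(1)] i(2) by auto
          next
            case False
            then show ?thesis using uniq[OF \<open>j < n\<close>] by fastforce
          qed
        next
          case False
          \<comment> \<open>Beyond \<open>n\<close> both points are \<open>undefined\<close> by
            extensionality.\<close>
          then show ?thesis using x y i(1) by (auto simp: cube_def PiE_iff extensional_def)
        qed
        then show "y \<in> (\<lambda>i. x(i := 1 - x i)) ` {..<n}" using i(1) by blast
      qed
    qed
  qed
  moreover have "cube n \<noteq> {}"
    using card_cube[of n] by auto
  ultimately show ?thesis
    by (simp add: dirichlet_form_def flip_energy_def integral_pmf_of_set card_cube)
qed

text \<open>Flips below \<open>n\<close> stay inside a half; flips of coordinate \<open>n\<close>
  cross over, and counting them from both ends gives the factor 2.\<close>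

lemma flip_energy_Suc:
  "flip_energy (Suc n) g =
    flip_energy n (\<lambda>x. g (x(n := 0))) + flip_energy n (\<lambda>x. g (x(n := 1)))
    + 2 * (\<Sum>x\<in>cube n. (g (x(n := 0)) - g (x(n := 1)))\<^sup>2)"
proof -
  have "(\<Sum>i<n. (g (x(n := b)) - g ((x(n := b))(i := 1 - (x(n := b)) i)))\<^sup>2)
      = (\<Sum>i<n. (g (x(n := b)) - g ((x(i := 1 - x i))(n := b)))\<^sup>2)" for x b
    by (intro sum.cong) (auto simp: fun_upd_twist)
  moreover have "(g (x(n := 1)) - g (x(n := 0)))\<^sup>2 = (g (x(n := 0)) - g (x(n := 1)))\<^sup>2" for x
    by (rule power2_commute)
  ultimately show ?thesis
    unfolding flip_energy_def sum_cube_Suc lessThan_Suc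
    by (simp add: sum.distrib del: One_nat_def)
qed

lemma flip_energy_abs_le: "flip_energy n (\<lambda>x. \<bar>g x\<bar>) \<le> flip_energy n g"
  unfolding flip_energy_def
  by (intro sum_mono) (simp add: abs_le_square_iff[symmetric] abs_triangle_ineq3)

section \<open>Induction on the dimension\<close>

text \<open>
  Since \<open>x / 0 = 0\<close>, the case \<open>A = {}\<close> is included; the induction needs it when \<open>A\<close> misses a half.
\<close>

lemma flip_energy_lower_bound:
  assumes "A \<subseteq> cube n" and "\<And>x. x \<in> cube n \<Longrightarrow> 0 \<le> g x"
    and "\<And>x. x \<in> cube n - A \<Longrightarrow> g x = 0"
  shows "2 * ((sum g (cube n))\<^sup>2 / real (card A) * (real n - log 2 (real (card A))))
    \<le> flip_energy n g"
  using assms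
proof (induction n arbitrary: A g)
  case 0
  \<comment> \<open>Either way the left side is 0: by division by zero, or because
    \<open>log 2 1 = 0\<close>.\<close>
  have "card A \<le> 1"
    using card_mono[OF finite_cube "0.prems"(1)] by (simp add: card_cube)
  then have "card A = 0 \<or> card A = 1" by linarith
  then show ?case by (auto simp: flip_energy_def)
next
  case (Suc n)
  define B where "B b = {x \<in> cube n. x(n := b) \<in> A}" for b
  define f where "f b x = g (x(n := b))" for b x
  define s where "s b = sum (f b) (cube n)" for b
  define m where "m b = real (card (B b))" for b
  have f0: "f b x = 0" if "b \<in> {0, 1}" "x \<in> cube n - B b" for b x
    unfolding f_def using that cube_extend[of x n b]
    by (intro Suc.prems(3) DiffI) (blast, unfold B_def, blast)
  have fpos: "0 \<le> f b x" if "b \<in> {0, 1}" "x \<in> cube n" for b x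
    unfolding f_def by (intro Suc.prems(2) cube_extend that)
  have IH: "2 * ((s b)\<^sup>2 / m b * (real n - log 2 (m b))) \<le> flip_energy n (f b)"
    if "b \<in> {0, 1}" for b
    unfolding s_def m_def
    by (intro Suc.IH f0 fpos that) (auto simp: B_def)
  have m_le: "log 2 (m b) \<le> real n" if "0 < m b" for b
  proof -
    have "card (B b) \<le> 2 ^ n"
      using card_mono[of "cube n" "B b"] by (auto simp: B_def card_cube)
    then have "m b \<le> real (2 ^ n)" unfolding m_def by (rule of_nat_mono)
    then show ?thesis
      using that by (simp add: log_le_iff powr_realpow)
  qed
  have cardA: "real (card A) = m 0 + m 1"
  proof -
    \<comment> \<open>Cardinalities become sums of indicators, so that \<open>sum_cube_Suc\<close>
      splits them too.\<close>
    have ind: "real (card C) = (\<Sum>x\<in>cube k. if x \<in> C then 1 else 0)" if "C \<subseteq> cube k" for C k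
      using that by (simp add: sum.If_cases Int_absorb1)
    have B: "B b \<subseteq> cube n" for b by (auto simp: B_def)
    show ?thesis
      unfolding m_def ind[OF Suc.prems(1)] ind[OF B] sum_cube_Suc
      by (intro arg_cong2[of _ _ _ _ "(+)"] sum.cong) (auto simp: B_def)
  qed
  have sumA: "sum g (cube (Suc n)) = s 0 + s 1"
    by (simp add: sum_cube_Suc s_def f_def)
  define cross where "cross = (\<Sum>x\<in>cube n. (f 0 x - f 1 x)\<^sup>2)"
  have cross: "(s 0 - s 1)\<^sup>2 \<le> max (m 0) (m 1) * cross"
    unfolding s_def m_def cross_def
    by (intro sum_diff_squared_le_max f0 fpos) (auto simp: B_def)
  have m_nonneg: "0 \<le> m b" for b by (simp add: m_def)
  have s_zero: "s b = 0" if "m b = 0" "b \<in> {0, 1}" for b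
  proof -
    have "B b = {}" using that(1) by (simp add: m_def B_def)
    then show ?thesis using f0[OF that(2)] by (simp add: s_def)
  qed
  have cross': "(s 0 - s 1)\<^sup>2 / max (m 0) (m 1) \<le> cross"
  proof (cases "max (m 0) (m 1) = 0")
    case True
    \<comment> \<open>The quotient is 0 here, and \<open>cross\<close> is a sum of squares.\<close>
    then show ?thesis by (simp add: cross_def sum_nonneg)
  next
    case False
    then have "0 < max (m 0) (m 1)" using m_nonneg[of 0] m_nonneg[of 1] by linarith
    then show ?thesis using cross by (simp add: pos_divide_le_eq mult.commute)
  qed
  have "(s 0 + s 1)\<^sup>2 / (m 0 + m 1) * (real n + 1 - log 2 (m 0 + m 1))
    \<le> (s 0)\<^sup>2 / m 0 * (real n - log 2 (m 0)) + (s 1)\<^sup>2 / m 1 * (real n - log 2 (m 1))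
      + (s 0 - s 1)\<^sup>2 / max (m 0) (m 1)"
  proof -
    \<comment> \<open>If \<open>A\<close> misses a half, the sum there is 0 and equality holds: the
      extra 1 on the left matches the crossing term.\<close>
    consider "m 0 = 0" | "m 1 = 0" | "0 < m 0" "0 < m 1"
      using m_nonneg[of 0] m_nonneg[of 1] by linarith
    then show ?thesis
    proof cases
      case 1
      then show ?thesis using s_zero[of 0] m_nonneg[of 1]
        by (simp add: algebra_simps add_divide_distrib diff_divide_distrib)
    next
      case 2
      then show ?thesis using s_zero[of 1] m_nonneg[of 0]
        by (simp add: algebra_simps add_divide_distrib diff_divide_distrib)
    next
      case 3
      then show ?thesis by (intro two_point m_le)
    qed
  qed
  moreover have "flip_energy (Suc n) g = flip_energy n (f 0) + flip_energy n (f 1) + 2 * cross"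
    by (simp add: flip_energy_Suc f_def[abs_def] cross_def)
  ultimately show ?case
    using IH[of 0] IH[of 1] cross' by (simp add: cardA sumA add.commute)
qed

theorem theorem1p1:
  fixes n :: nat and A :: "(nat \<Rightarrow> nat) set" and g :: "(nat \<Rightarrow> nat) \<Rightarrow> real"
  assumes "n \<ge> 1"
    and "A \<subseteq> cube n" and "A \<noteq> {}"
    and "\<And>x. x \<in> cube n \<Longrightarrow> x \<notin> A \<Longrightarrow> g x = 0"
  shows "dirichlet_form n g \<ge>
    2 * (1 / (2 ^ n * real (card A))) * log 2 (2 ^ n / real (card A)) * (\<Sum>x\<in>A. \<bar>g x\<bar>)\<^sup>2"
proof -
  have "0 < card A"
    using assms(2,3) finite_subset[OF assms(2) finite_cube] by (simp add: card_gt_0_iff)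
  then have log: "log 2 (2 ^ n / real (card A)) = real n - log 2 (real (card A))"
    by (simp add: log_divide log_nat_power)
  have "(\<Sum>x\<in>A. \<bar>g x\<bar>) = (\<Sum>x\<in>cube n. \<bar>g x\<bar>)"
    using assms(2,4) by (intro sum.mono_neutral_left) auto
  \<comment> \<open>The bound is applied to \<open>\<bar>g\<bar>\<close>, and
    \<open>flip_energy_abs_le\<close> returns to \<open>g\<close>.\<close>
  then have "2 * ((\<Sum>x\<in>A. \<bar>g x\<bar>)\<^sup>2 / real (card A) * (real n - log 2 (real (card A))))
      \<le> flip_energy n g"
    using flip_energy_lower_bound[of A n "\<lambda>x. \<bar>g x\<bar>"] assms(2,4) flip_energy_abs_le[of n g]
    by simp
  then have "2 * ((\<Sum>x\<in>A. \<bar>g x\<bar>)\<^sup>2 / real (card A) * (real n - log 2 (real (card A)))) / 2 ^ n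
      \<le> dirichlet_form n g"
    unfolding dirichlet_form_eq by (rule divide_right_mono) simp
  then show ?thesis
    by (simp add: log algebra_simps)
qed

end
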